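(* Every interval graph $G$ has an equitable tree-$k$-coloring for every integer $k\geq \lceil(\Delta(G)+1)/2\rceil$, where $\Delta(G)$ is the maximum degree of $G$. Moreover, the lower bound on $k$ is sharp: there exist interval graphs $G$ that admit no equitable tree-$k$-coloring for some $k=\lceil(\Delta(G)+1)/2\rceil-1$.
   Context: All graphs are finite, simple and undirected. An equitable tree-$k$-coloring of a graph $G$ is a map $c:V(G)\to\{1,\dots,k\}$ such that for each $i$, the set $c^{-1}(i)$ induces a forest in $G$, and $\big||c^{-1}(i)|-|c^{-1}(j)|\big|\le 1$ for all $1\le i<j\le k$. A graph $G$ is an interval graph if there is a family $\{T_v: v\in V(G)\}$ of intervals on the real line such that distinct $u,v$ are adjacent iff $T_u\cap T_v\neq\emptyset$. *)

theory Defs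
  imports "HOL-Analysis.Analysis" "Graph_Theory.Graph_Theory"
begin

text \<open>
  Finite simple undirected graphs are the \<open>pair_graph\<close>s of \<open>Graph_Theory\<close>: each undirected edge
  is represented by its two opposite arcs.  Hence the degree of a vertex is its out-degree.  The
  graph without vertices is allowed and gets maximum degree 0.
\<close>

definition max_degree :: "'a pair_pre_digraph \<Rightarrow> nat" where
  "max_degree G = Max (insert 0 (out_degree (with_proj G) ` pverts G))"

text \<open>
  The constant \<open>forest\<close> of \<open>Graph_Theory\<close> is unsuitable here: it forbids directed cycles of every
  length, so it fails for any symmetric digraph with an arc, because of the closed walk
  \<open>u, v, u\<close>.  The cycles of an undirected simple graph are the ones of length at least 3.
\<close>

definition undirected_forest :: "('a, 'b) pre_digraph \<Rightarrow> bool" where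
  "undirected_forest H \<longleftrightarrow> \<not> (\<exists>p. pre_digraph.cycle H p \<and> 3 \<le> length p)"

definition color_class :: "'a pair_pre_digraph \<Rightarrow> ('a \<Rightarrow> nat) \<Rightarrow> nat \<Rightarrow> 'a set" where
  "color_class G c i = {v \<in> pverts G. c v = i}"

definition equitable_tree_coloring :: "'a pair_pre_digraph \<Rightarrow> nat \<Rightarrow> ('a \<Rightarrow> nat) \<Rightarrow> bool" where
  "equitable_tree_coloring G k c \<longleftrightarrow>
     c \<in> pverts G \<rightarrow> {1..k} \<and>
     (\<forall>i\<in>{1..k}. undirected_forest (with_proj G \<restriction> color_class G c i)) \<and>
     (\<forall>i j. 1 \<le> i \<and> i < j \<and> j \<le> k \<longrightarrow>
        \<bar>int (card (color_class G c i)) - int (card (color_class G c j))\<bar> \<le> 1)"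

text \<open>
  Intervals may be open, closed, half-open, unbounded, single points or empty; for finite graphs all these
  choices yield the same class.
\<close>

definition interval_graph :: "'a pair_pre_digraph \<Rightarrow> bool" where
  "interval_graph G \<longleftrightarrow>
     pair_graph G \<and>
     (\<exists>T :: 'a \<Rightarrow> real set.
        (\<forall>v\<in>pverts G. is_interval (T v)) \<and>
        (\<forall>u\<in>pverts G. \<forall>v\<in>pverts G. u \<noteq> v \<longrightarrow>
           ((u, v) \<in> parcs G \<longleftrightarrow> T u \<inter> T v \<noteq> {})))"

end

theory Submission
  imports Defs
begin

text \<open>
  List the vertices in the order of the left endpoints of their intervals and color them cyclically
  with \<open>1, \<dots>, k\<close>.  If \<open>u\<close> has two later neighbours of its own color, the farther one is at least
  \<open>2k\<close> places after \<open>u\<close>; its interval starts inside that of \<open>u\<close>, so \<open>u\<close> is adjacent to all vertices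
  in between and has degree at least \<open>2k > \<Delta>\<close>.  Hence every vertex has at most one later neighbour
  in its color class, whereas the first vertex of a cycle has two.  The triangle \<open>K3\<close> with
  \<open>k = 1\<close> shows sharpness.
\<close>

section \<open>Cycles in digraphs and a local criterion for forests\<close>

context pre_digraph
begin

lemma cas_nth_Suc:
  assumes "cas u p v" "Suc i < length p"
  shows "head G (p ! i) = tail G (p ! Suc i)"
  using assms
proof (induction p arbitrary: u i)
  case (Cons e es)
  then show ?case
    by (cases i; cases es) auto
qed simp

lemma cas_hd_last:
  assumes "cas u p v" "p \<noteq> []"
  shows "tail G (hd p) = u" "head G (last p) = v"
  using assms by (induction p arbitrary: u) (auto split: if_splits)

text \<open>After the last arc the walk is back at its start vertex, the tail of arc 0, so all
  positions can be treated cyclically.\<close>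

lemma cycle_nth_mod:
  assumes "cycle p" "i < length p"
  shows "head G (p ! i) = tail G (p ! (Suc i mod length p))"
proof -
  obtain u where u: "cas u p u" "p \<noteq> []"
    using assms(1) by (auto simp: cycle_def awalk_def)
  show ?thesis
  proof (cases "Suc i < length p")
    case True
    then show ?thesis using cas_nth_Suc[OF u(1)] by simp
  next
    case False
    then have "Suc i = length p" using assms(2) by simp
    then show ?thesis
      using cas_hd_last[OF u] u(2) by (metis diff_Suc_1 hd_conv_nth last_conv_nth mod_self)
  qed
qed

text \<open>The heads are the entries of \<open>awalk_verts\<close> after the first, and these are
  what \<open>cycle\<close> requires to be distinct.\<close>

lemma cycle_distinct_heads:
  assumes "cycle p"
  shows "distinct (map (head G) p)"
  using assms by (auto simp: cycle_def awalk_def awalk_verts_conv')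

text \<open>The vertex sought is a head at which \<open>f\<close> is minimal; \<open>d\<close> and
  \<open>e\<close> are the arcs of the cycle entering and leaving it.\<close>

lemma cycle_local_minimum:
  fixes f :: "'a \<Rightarrow> 'c :: linorder"
  assumes p: "cycle p" "3 \<le> length p"
  obtains d e where "d \<in> set p" "e \<in> set p" "head G d = tail G e" "tail G d \<noteq> head G e"
    "f (head G d) \<le> f (tail G d)" "f (head G d) \<le> f (head G e)"
proof -
  let ?m = "length p"
  let ?g = "\<lambda>i. f (head G (p ! i))"
  define i where "i = arg_min_on ?g {..<?m}"
  have ne: "{..<?m} \<noteq> {}" using p(2) by (auto simp: lessThan_empty_iff)
  have i: "i < ?m"
    using arg_min_if_finite(1)[OF finite_lessThan ne, of ?g] by (simp add: i_def)
  have min: "?g i \<le> ?g j" if "j < ?m" for j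
    using arg_min_least[OF finite_lessThan ne, of j ?g] that by (simp add: i_def)
  \<comment> \<open>The cyclic predecessor and successor of \<open>i\<close>; they differ because
    the cycle has at least three arcs.\<close>
  define h j where "h = (if i = 0 then ?m - 1 else i - 1)" and "j = (if Suc i = ?m then 0 else Suc i)"
  have hj: "h < ?m" "j < ?m" "h \<noteq> j" "Suc h mod ?m = i" "Suc i mod ?m = j"
    using i p(2) by (auto simp: h_def j_def)
  have *: "tail G (p ! i) = head G (p ! h)" "head G (p ! i) = tail G (p ! j)"
    using cycle_nth_mod[OF p(1) hj(1)] cycle_nth_mod[OF p(1) i] hj(4,5) by auto
  have "head G (p ! h) \<noteq> head G (p ! j)"
    using cycle_distinct_heads[OF p(1)] hj(1-3) by (simp add: distinct_conv_nth)
  then show thesis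
    using that[of "p ! i" "p ! j"] i hj(1,2) min[of h] min[of j] * by auto
qed

end

text \<open>A cycle of length at least 3 would contain a vertex of least rank with two different
  neighbours, so it suffices to check pairs of consecutive arcs.\<close>

lemma undirected_forestI:
  fixes r :: "'a \<Rightarrow> 'c :: linorder"
  assumes "\<And>d e. \<lbrakk>d \<in> arcs H; e \<in> arcs H; head H d = tail H e;
      r (head H d) \<le> r (tail H d); r (head H d) \<le> r (head H e)\<rbrakk> \<Longrightarrow> tail H d = head H e"
  shows "undirected_forest H"
  unfolding undirected_forest_def
proof
  assume "\<exists>p. pre_digraph.cycle H p \<and> 3 \<le> length p"
  then obtain p where p: "pre_digraph.cycle H p" "3 \<le> length p" by blast
  have "set p \<subseteq> arcs H"
    using p(1) by (auto simp: pre_digraph.cycle_def pre_digraph.awalk_def)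
  moreover obtain d e where "d \<in> set p" "e \<in> set p" "head H d = tail H e" "tail H d \<noteq> head H e"
    "r (head H d) \<le> r (tail H d)" "r (head H d) \<le> r (head H e)"
    using pre_digraph.cycle_local_minimum[OF p] by metis
  ultimately show False using assms by blast
qed

section \<open>Rankings and residue classes\<close>

lemma ex_ranking:
  fixes f :: "'a \<Rightarrow> 'c :: linorder"
  assumes "finite A"
  obtains r where "bij_betw r A {..<card A}"
    "\<And>u v. u \<in> A \<Longrightarrow> v \<in> A \<Longrightarrow> r u < r v \<Longrightarrow> f u \<le> f v"
proof -
  obtain ys where ys: "set ys = A" "distinct ys"
    using finite_distinct_list[OF assms] by blast
  define xs where "xs = sort_key f ys"
  have xs: "set xs = A" "distinct xs" "sorted (map f xs)" "length xs = card A"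
    using ys by (auto simp: xs_def distinct_card)
  have bij: "bij_betw ((!) xs) {..<card A} A"
    by (rule bij_betw_nth) (use xs in auto)
  \<comment> \<open>The position in the sorted list: elements with equal \<open>f\<close> still get
    different ranks.\<close>
  define r where "r = the_inv_into {..<card A} ((!) xs)"
  have r: "bij_betw r A {..<card A}"
    unfolding r_def by (rule bij_betw_the_inv_into[OF bij])
  have nth_r: "xs ! r u = u" if "u \<in> A" for u
    unfolding r_def by (rule f_the_inv_into_f_bij_betw[OF bij]) (use that in simp)
  show thesis
  proof (rule that[OF r])
    fix u v assume uv: "u \<in> A" "v \<in> A" "r u < r v"
    have "r v < length xs" using r uv(2) xs(4) by (auto simp: bij_betw_def)
    then show "f u \<le> f v"
      using sorted_nth_mono[OF xs(3), of "r u" "r v"] uv nth_r by simp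
  qed
qed

text \<open>Each complete block of \<open>k\<close> consecutive numbers has one member, the
  remainder block at most one. This makes the cyclic coloring equitable.\<close>

lemma card_residue_class:
  fixes n k j :: nat
  assumes "j < k"
  shows "card {i. i < n \<and> i mod k = j} \<in> {n div k, Suc (n div k)}"
proof -
  \<comment> \<open>The extra 1 is for the remainder block, whose length \<open>n mod k\<close> must
    exceed \<open>j\<close> for it to contain a member.\<close>
  define t where "t = n div k + (if j < n mod k then 1 else 0)"
  have n: "n = n div k * k + n mod k" by simp
  have "{i. i < n \<and> i mod k = j} = (\<lambda>m. m * k + j) ` {..<t}"
  proof (intro set_eqI iffI)
    fix i assume "i \<in> {i. i < n \<and> i mod k = j}"
    then have i: "i < n" "i mod k = j" by auto
    have "i div k < t"
    proof (rule ccontr)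
      assume "\<not> i div k < t"
      then have ge: "n div k \<le> i div k" "j < n mod k \<Longrightarrow> n div k < i div k"
        by (auto simp: t_def split: if_splits)
      have "i div k \<le> n div k" using i(1) by (simp add: div_le_mono)
      then have eq: "i div k = n div k" using ge(1) by simp
      with ge(2) have "n mod k \<le> j" by linarith
      then have "n \<le> n div k * k + j" using n by linarith
      also have "\<dots> = i" using div_mult_mod_eq[of i k] eq i(2) by simp
      finally have "n \<le> i" .
      with i show False by simp
    qed
    moreover have "i = i div k * k + j" using i(2) div_mult_mod_eq[of i k] by simp
    ultimately show "i \<in> (\<lambda>m. m * k + j) ` {..<t}" by blast
  next
    fix i assume "i \<in> (\<lambda>m. m * k + j) ` {..<t}"
    then obtain m where m: "m < t" "i = m * k + j" by auto
    have "i < n"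
    proof (cases "m < n div k")
      case True
      then have "Suc m * k \<le> n div k * k" by (intro mult_le_mono1) simp
      then have "m * k + j < n div k * k" using assms by simp
      then show ?thesis using m(2) n by linarith
    next
      case False
      then have "m = n div k" "j < n mod k" using m(1) by (auto simp: t_def split: if_splits)
      then show ?thesis using m(2) add_strict_left_mono[of j "n mod k" "n div k * k"] by simp
    qed
    then show "i \<in> {i. i < n \<and> i mod k = j}" using m(2) assms by simp
  qed
  moreover have "inj_on (\<lambda>m. m * k + j) {..<t}"
    using assms by (auto simp: inj_on_def)
  ultimately have "card {i. i < n \<and> i mod k = j} = t" by (simp add: card_image)
  then show ?thesis by (auto simp: t_def)
qed

lemma mod_eq_less_imp_add_le:
  fixes a b k :: nat
  assumes "a mod k = b mod k" "a < b"
  shows "a + k \<le> b"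
proof -
  have "k dvd b - a" using assms by (metis mod_eq_dvd_iff_nat less_imp_le)
  then show ?thesis using assms(2) dvd_imp_le[of k "b - a"] by simp
qed

section \<open>Ordering intervals by their left endpoints\<close>

text \<open>
  The up-closures of the sets \<open>T v\<close> form a chain, so counting those that contain a given one ranks
  the intervals by their left endpoints even when the endpoints are not attained or infinite.
\<close>

lemma interval_graph_ranking:
  fixes G :: "'a pair_pre_digraph"
  assumes "interval_graph G"
  obtains r where "bij_betw r (pverts G) {..<card (pverts G)}"
    "\<And>u v w. \<lbrakk>v \<in> pverts G; (u, w) \<in> parcs G; r u < r v; r v < r w\<rbrakk> \<Longrightarrow> (u, v) \<in> parcs G"
proof -
  from assms interpret pair_graph G by (simp add: interval_graph_def)
  from assms obtain T :: "'a \<Rightarrow> real set" where interval: "\<forall>v\<in>pverts G. is_interval (T v)" and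
    adj: "\<forall>u\<in>pverts G. \<forall>v\<in>pverts G. u \<noteq> v \<longrightarrow> ((u, v) \<in> parcs G \<longleftrightarrow> T u \<inter> T v \<noteq> {})"
    unfolding interval_graph_def by (elim conjE exE)
  define U where "U v = {y. \<exists>x\<in>T v. x \<le> y}" for v
  have U_chain: "U u \<subseteq> U v \<or> U v \<subseteq> U u" for u v
  proof (rule ccontr)
    assume "\<not> ?thesis"
    then obtain x y where "x \<in> U u" "x \<notin> U v" "y \<in> U v" "y \<notin> U u" by blast
    then show False unfolding U_def by (cases "x \<le> y") (auto intro: order_trans)
  qed
  define f where "f v = card {w \<in> pverts G. U v \<subseteq> U w}" for v
  have f: "U v \<subseteq> U u" if "u \<in> pverts G" "v \<in> pverts G" "f u \<le> f v" for u v
  proof (rule ccontr)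
    assume not_sub: "\<not> U v \<subseteq> U u"
    then have "U u \<subseteq> U v" using U_chain by blast
    \<comment> \<open>The inclusion is proper because \<open>u\<close> lies in the second set but
      not in the first.\<close>
    with not_sub that(1) have "{w \<in> pverts G. U v \<subseteq> U w} \<subset> {w \<in> pverts G. U u \<subseteq> U w}" by blast
    then have "f v < f u"
      unfolding f_def by (rule psubset_card_mono[rotated]) simp
    with that(3) show False by simp
  qed
  obtain r where r: "bij_betw r (pverts G) {..<card (pverts G)}"
    "\<And>u v. \<lbrakk>u \<in> pverts G; v \<in> pverts G; r u < r v\<rbrakk> \<Longrightarrow> f u \<le> f v"
    using ex_ranking[OF pair_finite_verts, of f] by metis
  show thesis
  proof (rule that[OF r(1)])
    fix u v w assume v: "v \<in> pverts G" and uw: "(u, w) \<in> parcs G" and less: "r u < r v" "r v < r w"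
    have u: "u \<in> pverts G" and w: "w \<in> pverts G" using uw wellformed' by auto
    have "u \<noteq> w" using uw no_loops' by blast
    then obtain x where x: "x \<in> T u" "x \<in> T w" using adj u w uw by blast
    \<comment> \<open>The two inclusions yield \<open>y\<close> in \<open>T v\<close> with
      \<open>y \<le> x\<close> and \<open>z\<close> in \<open>T u\<close> with
      \<open>z \<le> y\<close>; convexity of \<open>T u\<close> then puts \<open>y\<close> into it.
      In particular \<open>T v\<close> is nonempty.\<close>
    have "U v \<subseteq> U u" "U w \<subseteq> U v" using f r(2) u v w less by blast+
    moreover have "x \<in> U w" using x(2) by (auto simp: U_def)
    ultimately obtain y where y: "y \<in> T v" "y \<le> x" by (auto simp: U_def)
    then have "y \<in> U u" using \<open>U v \<subseteq> U u\<close> by (auto simp: U_def)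
    then obtain z where "z \<in> T u" "z \<le> y" by (auto simp: U_def)
    then have "y \<in> T u"
      using mem_is_interval_1_I[OF bspec[OF interval u]] x(1) y(2) by blast
    then have "T u \<inter> T v \<noteq> {}" using y(1) by blast
    moreover have "u \<noteq> v" using less(1) by blast
    ultimately show "(u, v) \<in> parcs G" using adj u v by simp
  qed
qed

section \<open>Rank distance along edges and the cyclic coloring\<close>

lemma out_degree_le_max_degree:
  assumes "finite (pverts G)" "v \<in> pverts G"
  shows "out_degree (with_proj G) v \<le> max_degree G"
  unfolding max_degree_def using assms by (intro Max_ge) auto

text \<open>All vertices ranked after \<open>u\<close> and up to \<open>w\<close> are neighbours of
  \<open>u\<close>, and since the ranks fill \<open>{..<n}\<close> there are
  \<open>r w - r u\<close> of them.\<close>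

lemma out_degree_ge_rank_diff:
  assumes fin: "finite (parcs G)" and r: "bij_betw r (pverts G) {..<n}"
    and between: "\<And>v. \<lbrakk>v \<in> pverts G; r u < r v; r v < r w\<rbrakk> \<Longrightarrow> (u, v) \<in> parcs G"
    and uw: "(u, w) \<in> parcs G" "w \<in> pverts G"
  shows "r w - r u \<le> out_degree (with_proj G) u"
proof -
  let ?N = "{v \<in> pverts G. r v \<in> {r u<..r w}}"
  have inj: "inj_on r (pverts G)" using r by (rule bij_betw_imp_inj_on)
  have img: "r ` pverts G = {..<n}" using r by (rule bij_betw_imp_surj_on)
  then have "r w < n" using uw(2) by blast
  then have "{r u<..r w} \<subseteq> r ` pverts G" unfolding img by auto
  then have "r ` ?N = {r u<..r w}" by auto
  moreover have "inj_on r ?N" using inj by (auto simp: inj_on_def)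
  ultimately have "card ?N = r w - r u" using card_image[of r ?N] by simp
  then have "r w - r u = card (Pair u ` ?N)" by (simp add: card_image inj_on_def)
  also have "\<dots> \<le> out_degree (with_proj G) u"
    unfolding out_degree_def
  proof (rule card_mono)
    show "finite (out_arcs (with_proj G) u)" using fin by (simp add: out_arcs_def)
    show "Pair u ` ?N \<subseteq> out_arcs (with_proj G) u"
    proof
      fix a assume "a \<in> Pair u ` ?N"
      then obtain v where a: "a = (u, v)" and v: "v \<in> pverts G" "r u < r v" "r v \<le> r w" by auto
      have "(u, v) \<in> parcs G"
      proof (cases "v = w")
        case False
        then have "r v \<noteq> r w" using inj v(1) uw(2) by (auto dest: inj_onD)
        with v show ?thesis using between by simp
      qed (use uw in simp)
      with a show "a \<in> out_arcs (with_proj G) u" by simp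
    qed
  qed
  finally show ?thesis .
qed

text \<open>The hypothesis on \<open>k\<close> is the ceiling bound in integer form.\<close>

lemma interval_graph_equitable_tree_coloring:
  assumes G: "interval_graph G" and k: "max_degree G < 2 * k"
  shows "\<exists>c. equitable_tree_coloring G k c"
proof -
  interpret pair_graph G using G by (simp add: interval_graph_def)
  let ?n = "card (pverts G)"
  obtain r where r: "bij_betw r (pverts G) {..<?n}" and
    between: "\<And>u v w. \<lbrakk>v \<in> pverts G; (u, w) \<in> parcs G; r u < r v; r v < r w\<rbrakk> \<Longrightarrow> (u, v) \<in> parcs G"
    using interval_graph_ranking[OF G] by blast
  have inj: "inj_on r (pverts G)" using r by (rule bij_betw_imp_inj_on)
  have near: "r w < r u + 2 * k" if "(u, w) \<in> parcs G" for u w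
  proof -
    have "u \<in> pverts G" "w \<in> pverts G" using that wellformed' by auto
    then have "r w - r u \<le> out_degree (with_proj G) u" "out_degree (with_proj G) u \<le> max_degree G"
      using out_degree_ge_rank_diff[OF pair_finite_arcs r between[OF _ that] that]
        out_degree_le_max_degree[OF pair_finite_verts] by simp_all
    with k show ?thesis by simp
  qed
  \<comment> \<open>\<open>Suc\<close> shifts the residues to the colors \<open>1\<close> to
    \<open>k\<close>.\<close>
  define c where "c v = Suc (r v mod k)" for v
  \<comment> \<open>Equal colors force a rank gap of at least \<open>k\<close>; two such gaps
    contradict \<open>near\<close> for the arc from \<open>u\<close> to \<open>w\<close>.\<close>
  have sorted_case: False
    if "(u, v) \<in> parcs G" "(u, w) \<in> parcs G" "c u = c v" "c u = c w" "r u < r v" "r v < r w" for u v w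
  proof -
    have "r u + k \<le> r v" "r v + k \<le> r w"
      using that by (auto simp: c_def intro: mod_eq_less_imp_add_le)
    then show False using near[OF that(2)] by simp
  qed
  have forest: "undirected_forest (with_proj G \<restriction> color_class G c i)" for i
  proof (rule undirected_forestI[where r = r])
    let ?H = "with_proj G \<restriction> color_class G c i"
    fix d e
    assume d: "d \<in> arcs ?H" and e: "e \<in> arcs ?H" and eq: "head ?H d = tail ?H e"
      and le: "r (head ?H d) \<le> r (tail ?H d)" "r (head ?H d) \<le> r (head ?H e)"
    define u v w where "u = fst e" and "v = fst d" and "w = snd e"
    have de: "d = (v, u)" "e = (u, w)" using eq by (auto simp: u_def v_def w_def prod_eq_iff)
    have arcs: "(v, u) \<in> parcs G" "(u, w) \<in> parcs G" and col: "c u = i" "c v = i" "c w = i"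
      and verts: "u \<in> pverts G" "v \<in> pverts G" "w \<in> pverts G"
      using d e de by (auto simp: color_class_def)
    \<comment> \<open>Reversing the incoming arc makes \<open>v\<close> an out-neighbour of
      \<open>u\<close> like \<open>w\<close>, so \<open>sorted_case\<close> applies whichever of the
      two comes first.\<close>
    have uv: "(u, v) \<in> parcs G"
      using pair_sym_arcs arcs(1) by (auto simp: symmetric_def sym_def)
    have "r u \<noteq> r v" "r u \<noteq> r w"
      using inj verts no_loops'[OF uv] no_loops'[OF arcs(2)] by (auto dest: inj_onD)
    then have "r u < r v" "r u < r w" using le de by auto
    then have "r v = r w"
      using sorted_case[OF uv arcs(2)] sorted_case[OF arcs(2) uv] col by (metis nat_neq_iff)
    then show "tail ?H d = head ?H e" using inj verts de by (auto dest: inj_onD)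
  qed
  have size: "card (color_class G c i) \<in> {?n div k, Suc (?n div k)}" if i: "i \<in> {1..k}" for i
  proof -
    have "r ` color_class G c i = {a \<in> r ` pverts G. a mod k = i - 1}"
      using i by (auto simp: color_class_def c_def)
    also have "\<dots> = {a. a < ?n \<and> a mod k = i - 1}" using r by (auto simp: bij_betw_def)
    finally have "card (color_class G c i) = card {a. a < ?n \<and> a mod k = i - 1}"
      using card_image[of r "color_class G c i"] inj
      by (metis (no_types, lifting) color_class_def inj_on_subset mem_Collect_eq subsetI)
    then show ?thesis using card_residue_class[of "i - 1" k ?n] i by auto
  qed
  have "equitable_tree_coloring G k c"
    unfolding equitable_tree_coloring_def
  proof (intro conjI ballI allI impI)
    \<comment> \<open>The bound on \<open>k\<close> forces \<open>k > 0\<close>, hence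
      \<open>r v mod k < k\<close>.\<close>
    show "c \<in> pverts G \<rightarrow> {1..k}" using k by (auto simp: c_def Suc_le_eq)
    fix i j :: nat assume "1 \<le> i \<and> i < j \<and> j \<le> k"
    then show "\<bar>int (card (color_class G c i)) - int (card (color_class G c j))\<bar> \<le> 1"
      using size[of i] size[of j] by auto
  qed (rule forest)
  then show ?thesis by blast
qed

section \<open>Sharpness: the triangle\<close>

definition K3 :: "nat pair_pre_digraph" where
  "K3 = \<lparr>pverts = {..<3}, parcs = {..<3} \<times> {..<3} - Id\<rparr>"

lemma interval_graph_K3: "interval_graph K3"
proof -
  have "sym (parcs K3)" by (auto simp: K3_def sym_def)
  then have "pair_graph K3"
    by unfold_locales (simp_all add: symmetric_def, auto simp: K3_def)
  \<comment> \<open>Every vertex gets the whole real line, so any two intervals meet.\<close>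
  then show ?thesis
    unfolding interval_graph_def
    by (intro conjI exI[of _ "\<lambda>_. UNIV"]) (auto simp: K3_def)
qed

lemma max_degree_K3: "max_degree K3 = 2"
proof -
  have "out_degree (with_proj K3) v = 2" if "v \<in> pverts K3" for v
  proof -
    have "out_arcs (with_proj K3) v = Pair v ` ({..<3} - {v})"
      using that by (auto simp: out_arcs_def K3_def)
    then show ?thesis
      using that by (simp add: out_degree_def card_image inj_on_def K3_def)
  qed
  moreover have "pverts K3 \<noteq> {}" by (auto simp: K3_def lessThan_empty_iff)
  ultimately have "out_degree (with_proj K3) ` pverts K3 = {2}" by auto
  then show ?thesis by (simp add: max_degree_def)
qed

text \<open>With one color the only class is the whole triangle, whose arcs form a cycle of length
  3.\<close>

lemma not_equitable_tree_coloring_K3: "\<not> equitable_tree_coloring K3 1 c"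
proof
  assume "equitable_tree_coloring K3 1 c"
  then have c: "c \<in> pverts K3 \<rightarrow> {1}"
    and forest: "undirected_forest (with_proj K3 \<restriction> color_class K3 c 1)"
    by (auto simp: equitable_tree_coloring_def)
  let ?H = "with_proj K3 \<restriction> color_class K3 c 1"
  have cls: "color_class K3 c 1 = {..<3}"
    using c by (auto simp: color_class_def K3_def)
  have "pre_digraph.cycle ?H [(0, 1), (1, 2), (2, 0)]"
    unfolding pre_digraph.cycle_def cls
    by (rule exI[of _ 0])
      (simp add: pre_digraph.awalk_def pre_digraph.cas.simps pre_digraph.awalk_verts.simps K3_def)
  then have "\<exists>p. pre_digraph.cycle ?H p \<and> 3 \<le> length p"
    by (rule exI[of _ "[(0, 1), (1, 2), (2, 0)]", OF conjI]) simp
  then show False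
    using forest unfolding undirected_forest_def by blast
qed

theorem theorem1:
  shows "(\<forall>(G :: 'a pair_pre_digraph) (k :: nat).
            interval_graph G \<and> int k \<ge> \<lceil>(real (max_degree G) + 1) / 2\<rceil> \<longrightarrow>
            (\<exists>c. equitable_tree_coloring G k c)) \<and>
         (\<exists>(G :: nat pair_pre_digraph) (k :: nat).
            interval_graph G \<and> k \<ge> 1 \<and> int k = \<lceil>(real (max_degree G) + 1) / 2\<rceil> - 1 \<and>
            \<not> (\<exists>c. equitable_tree_coloring G k c))"
proof (intro conjI allI impI)
  fix G :: "'a pair_pre_digraph" and k :: nat
  assume G: "interval_graph G \<and> int k \<ge> \<lceil>(real (max_degree G) + 1) / 2\<rceil>"
  then have "(real (max_degree G) + 1) / 2 \<le> real k" by (simp add: ceiling_le_iff)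
  then have "real (Suc (max_degree G)) \<le> real (2 * k)" by simp
  then have "max_degree G < 2 * k" unfolding of_nat_le_iff by simp
  then show "\<exists>c. equitable_tree_coloring G k c"
    using G interval_graph_equitable_tree_coloring by blast
next
  \<comment> \<open>The ceiling of 3/2, so the number of colors just below the bound is 1.\<close>
  have "\<lceil>(real (max_degree K3) + 1) / 2\<rceil> = 2"
    unfolding max_degree_K3 by (rule ceiling_unique) auto
  then show "\<exists>(G :: nat pair_pre_digraph) (k :: nat).
      interval_graph G \<and> k \<ge> 1 \<and> int k = \<lceil>(real (max_degree G) + 1) / 2\<rceil> - 1 \<and>
      \<not> (\<exists>c. equitable_tree_coloring G k c)"
    using interval_graph_K3 not_equitable_tree_coloring_K3
    by (intro exI[of _ K3] exI[of _ 1]) simp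
qed

end
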